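(* Let $\Omega \subset \mathbb{R}^n_{\geq 0}$ be a smooth, compact domain that is starshaped with respect to the origin, so that the associated toric domain $X_\Omega = \mu^{-1}(\Omega) \subset \mathbb{C}^n$ is smooth, compact and starshaped with respect to the origin. Then for every $\theta\in\mathbb{R}^n$ the symmetric ratio satisfies $$\mathfrak{R}(\partial X_\Omega, \rho_\theta) = 1 .$$
   Context: Identify $\mathbb{C}^n$ with $\mathbb{R}^{2n}$ via $z_j=x_j+iy_j$ and let $\lambda_0=\tfrac12\sum_{j=1}^n(x_j\,dy_j-y_j\,dx_j)$. The moment map is $\mu:\mathbb{C}^n\to\mathbb{R}^n_{\ge0}$, $\mu(z_1,\dots,z_n)=\pi(|z_1|^2,\dots,|z_n|^2)$, and the toric domain of $\Omega\subset\mathbb{R}^n_{\ge0}$ is $X_\Omega:=\mu^{-1}(\Omega)$. Saying that $X_\Omega$ is smooth, compact and starshaped means that it is a compact domain with smooth boundary containing the origin in its interior, and that the radial vector field is transverse to $\partial X_\Omega$ (pointing outward); then $\alpha=\lambda_0|_{\partial X_\Omega}$ is a contact form on $\partial X_\Omega$. For $\theta=(\theta_1,\dots,\theta_n)\in\mathbb{R}^n$ set $\rho_\theta(z)=(e^{i\theta_1}\overline{z}_1,\dots,e^{i\theta_n}\overline{z}_n)$. This is an involution with $\rho_\theta^*\lambda_0=-\lambda_0$, and every toric domain is $\rho_\theta$-invariant. For a contact form $\alpha$ on a closed connected manifold $\Sigma$, the Reeb vector field $R$ is determined by $d\alpha(R,\cdot)=0$, $\alpha(R)=1$. A periodic orbit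 of period $\tau>0$ is a smooth curve $\gamma:\mathbb{R}/\tau\mathbb{Z}\to\Sigma$ with $\dot\gamma=R\circ\gamma$. If $\rho$ is an involution of $\Sigma$ with $\rho^*\alpha=-\alpha$, $\gamma$ is symmetric if $\rho(\mathrm{Im}(\gamma))=\mathrm{Im}(\gamma)$. The systole $\ell_{\min}$ is the infimum of the periods of all periodic orbits, the symmetric systole $\ell_{\min}^{\mathrm{sym}}$ is the infimum of the periods of all symmetric periodic orbits (infimum of the empty set is $\infty$), and the symmetric ratio is $\mathfrak{R}=\ell_{\min}^{\mathrm{sym}}/\ell_{\min}$. Here $\mathfrak{R}(\partial X_\Omega,\rho_\theta)$ is the symmetric ratio for $\Sigma=\partial X_\Omega$, $\alpha=\lambda_0|_{\partial X_\Omega}$ and $\rho=\rho_\theta|_{\partial X_\Omega}$. *)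

theory Defs
  imports "HOL-Analysis.Analysis"
begin

text \<open>\<open>C^k\<close> and \<open>C^\<infinity>\<close> maps; meant for open sets \<open>S\<close> in finite-dimensional spaces.\<close>

primrec Ck_on ::
  "nat \<Rightarrow> ('a::real_normed_vector \<Rightarrow> 'b::real_normed_vector) \<Rightarrow> 'a set \<Rightarrow> bool" where
  "Ck_on 0 f S \<longleftrightarrow> continuous_on S f"
| "Ck_on (Suc k) f S \<longleftrightarrow>
     (\<forall>x\<in>S. f differentiable (at x)) \<and>
     (\<forall>v. Ck_on k (\<lambda>x. frechet_derivative f (at x) v) S)"

definition smooth_on ::
  "('a::real_normed_vector \<Rightarrow> 'b::real_normed_vector) \<Rightarrow> 'a set \<Rightarrow> bool" where
  "smooth_on f S \<longleftrightarrow> (\<forall>k. Ck_on k f S)"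

text \<open>A codimension-0 domain \<open>X\<close> is given near a boundary point \<open>p\<close> as a regular sublevel set
  \<open>f \<le> 0\<close>, so that its boundary is locally the regular level set \<open>f = 0\<close>. The kernel of the
  derivative of \<open>f\<close> at \<open>p\<close>, and the side on which this derivative is positive, do not depend on
  the choice of \<open>f\<close>.\<close>

definition local_defining_function ::
  "'a::euclidean_space set \<Rightarrow> 'a \<Rightarrow> 'a set \<Rightarrow> ('a \<Rightarrow> real) \<Rightarrow> bool" where
  "local_defining_function X p U f \<longleftrightarrow>
     open U \<and> p \<in> U \<and> smooth_on f U \<and> f p = 0 \<and>
     (\<forall>x\<in>U. \<exists>v. frechet_derivative f (at x) v \<noteq> 0) \<and>
     X \<inter> U = {x \<in> U. f x \<le> 0}"

definition has_smooth_boundary :: "'a::euclidean_space set \<Rightarrow> bool" where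
  "has_smooth_boundary X \<longleftrightarrow>
     (\<forall>p\<in>frontier X. \<exists>U f. local_defining_function X p U f)"

definition boundary_tangent_space :: "'a::euclidean_space set \<Rightarrow> 'a \<Rightarrow> 'a set" where
  "boundary_tangent_space X p =
     {v. \<exists>U f. local_defining_function X p U f \<and> frechet_derivative f (at p) v = 0}"

definition points_outward :: "'a::euclidean_space set \<Rightarrow> 'a \<Rightarrow> 'a \<Rightarrow> bool" where
  "points_outward X p v \<longleftrightarrow>
     (\<exists>U f. local_defining_function X p U f \<and> frechet_derivative f (at p) v > 0)"

text \<open>The value of the radial vector field at \<open>p\<close> is \<open>p\<close> itself.\<close>

definition smooth_compact_starshaped :: "'a::euclidean_space set \<Rightarrow> bool" where
  "smooth_compact_starshaped X \<longleftrightarrow>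
     compact X \<and> 0 \<in> interior X \<and> has_smooth_boundary X \<and>
     (\<forall>p\<in>frontier X. points_outward X p p)"

text \<open>A 1-form \<open>\<alpha>\<close> on a vector space is a map taking a point and a tangent vector to a real
  number. Below, the contact form on \<open>frontier X\<close> is the restriction of \<open>\<alpha>\<close>, whose exterior
  derivative is the restriction of that of \<open>\<alpha>\<close>.\<close>

definition exterior_derivative ::
  "('a::real_normed_vector \<Rightarrow> 'a \<Rightarrow> real) \<Rightarrow> 'a \<Rightarrow> 'a \<Rightarrow> 'a \<Rightarrow> real" where
  "exterior_derivative \<alpha> p u v =
     frechet_derivative (\<lambda>x. \<alpha> x v) (at p) u - frechet_derivative (\<lambda>x. \<alpha> x u) (at p) v"

definition Reeb_vector_field ::
  "'a::euclidean_space set \<Rightarrow> ('a \<Rightarrow> 'a \<Rightarrow> real) \<Rightarrow> 'a \<Rightarrow> 'a" where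
  "Reeb_vector_field X \<alpha> p =
     (THE R. R \<in> boundary_tangent_space X p \<and>
             (\<forall>v\<in>boundary_tangent_space X p. exterior_derivative \<alpha> p R v = 0) \<and>
             \<alpha> p R = 1)"

text \<open>Curves on \<open>\<real>/\<tau>\<int>\<close> are encoded as \<open>\<tau>\<close>-periodic curves on \<open>\<real>\<close>; \<open>\<tau>\<close> need not be the
  minimal period.\<close>

definition periodic_Reeb_orbit ::
  "'a::euclidean_space set \<Rightarrow> ('a \<Rightarrow> 'a \<Rightarrow> real) \<Rightarrow> real \<Rightarrow> (real \<Rightarrow> 'a) \<Rightarrow> bool" where
  "periodic_Reeb_orbit X \<alpha> \<tau> \<gamma> \<longleftrightarrow>
     \<tau> > 0 \<and> smooth_on \<gamma> UNIV \<and> (\<forall>t. \<gamma> (t + \<tau>) = \<gamma> t) \<and> (\<forall>t. \<gamma> t \<in> frontier X) \<and>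
     (\<forall>t. (\<gamma> has_vector_derivative Reeb_vector_field X \<alpha> (\<gamma> t)) (at t))"

definition symmetric_curve :: "('a \<Rightarrow> 'a) \<Rightarrow> (real \<Rightarrow> 'a) \<Rightarrow> bool" where
  "symmetric_curve \<rho> \<gamma> \<longleftrightarrow> \<rho> ` range \<gamma> = range \<gamma>"

definition systole :: "'a::euclidean_space set \<Rightarrow> ('a \<Rightarrow> 'a \<Rightarrow> real) \<Rightarrow> ereal" where
  "systole X \<alpha> = Inf {ereal \<tau> | \<tau>. \<exists>\<gamma>. periodic_Reeb_orbit X \<alpha> \<tau> \<gamma>}"

definition symmetric_systole ::
  "'a::euclidean_space set \<Rightarrow> ('a \<Rightarrow> 'a \<Rightarrow> real) \<Rightarrow> ('a \<Rightarrow> 'a) \<Rightarrow> ereal" where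
  "symmetric_systole X \<alpha> \<rho> =
     Inf {ereal \<tau> | \<tau>. \<exists>\<gamma>. periodic_Reeb_orbit X \<alpha> \<tau> \<gamma> \<and> symmetric_curve \<rho> \<gamma>}"

text \<open>In \<open>ereal\<close> both \<open>0 / 0\<close> and \<open>\<infinity> / \<infinity>\<close> evaluate to \<open>0\<close>, so a ratio equal to 1 forces both
  systoles to be positive and finite.\<close>

definition symmetric_ratio ::
  "'a::euclidean_space set \<Rightarrow> ('a \<Rightarrow> 'a \<Rightarrow> real) \<Rightarrow> ('a \<Rightarrow> 'a) \<Rightarrow> ereal" where
  "symmetric_ratio X \<alpha> \<rho> = symmetric_systole X \<alpha> \<rho> / systole X \<alpha>"

definition liouville_form :: "complex^'n \<Rightarrow> complex^'n \<Rightarrow> real" where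
  "liouville_form z v = (1/2) * (\<Sum>j\<in>UNIV. Re (z$j) * Im (v$j) - Im (z$j) * Re (v$j))"

definition moment_map :: "complex^'n \<Rightarrow> real^'n" where
  "moment_map z = (\<chi> j. pi * (cmod (z$j))\<^sup>2)"

definition toric_domain :: "(real^'n) set \<Rightarrow> (complex^'n) set" where
  "toric_domain \<Omega> = moment_map -` \<Omega>"

definition rho :: "real^'n \<Rightarrow> complex^'n \<Rightarrow> complex^'n" where
  "rho \<theta> z = (\<chi> j. exp (\<i> * complex_of_real (\<theta>$j)) * cnj (z$j))"

end

theory Submission
  imports Defs
begin

text \<open>Since \<open>X\<close> is invariant under the torus action, its outer normal at a boundary point \<open>p\<close>
  has the form \<open>g$j = a$j * p$j\<close> with \<open>a$j\<close> real, and the Reeb vector field is the multiple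
  \<open>2 / (g \<bullet> p)\<close> of \<open>\<i> * g\<close>. So Reeb orbits are the curves \<open>cis (t * b$j) * p$j\<close>, with
  rotation speeds \<open>b\<close> constant along torus orbits. Translating a closed orbit by the torus to a
  fixed point of \<open>rho \<theta>\<close> gives a symmetric closed orbit of the same period, so the symmetric
  systole is the systole. It is finite because the boundary points on a coordinate axis lie on
  closed orbits, and positive because the rotation speeds are bounded.\<close>

subsection \<open>Outer normals\<close>

text \<open>Only differentiability at \<open>p\<close> is required, so that the notion is visibly invariant
  under linear symmetries of \<open>X\<close>.\<close>

definition outer_normal :: "'a::euclidean_space set \<Rightarrow> 'a \<Rightarrow> 'a \<Rightarrow> bool" where
  "outer_normal X p g \<longleftrightarrow> g \<noteq> 0 \<and>
     (\<exists>f. f p = 0 \<and> (f has_derivative (\<lambda>v. g \<bullet> v)) (at p) \<and>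
          (\<forall>\<^sub>F x in nhds p. x \<in> X \<longleftrightarrow> f x \<le> (0::real)))"

text \<open>Since \<open>f p = 0\<close>, the quotient \<open>f (p + t *\<^sub>R v) / t\<close>
  tends to \<open>g \<bullet> v\<close>, so for small \<open>t > 0\<close> the sign of
  \<open>f\<close> on the ray is that of \<open>g \<bullet> v\<close>.\<close>

lemma outer_normal_ray:
  assumes "outer_normal X p g"
  shows "g \<bullet> v > 0 \<Longrightarrow> \<forall>\<^sub>F t in at_right 0. p + t *\<^sub>R v \<notin> X"
    and "g \<bullet> v < 0 \<Longrightarrow> \<forall>\<^sub>F t in at_right 0. p + t *\<^sub>R v \<in> X"
proof -
  obtain f where f: "f p = 0" "(f has_derivative (\<lambda>v. g \<bullet> v)) (at p)"
    and X: "\<forall>\<^sub>F x in nhds p. x \<in> X \<longleftrightarrow> f x \<le> (0::real)"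
    using assms unfolding outer_normal_def by blast
  have "((\<lambda>t. p + t *\<^sub>R v) \<longlongrightarrow> p + 0 *\<^sub>R v) (at_right 0)"
    by (intro tendsto_intros)
  hence ev: "\<forall>\<^sub>F t in at_right 0. p + t *\<^sub>R v \<in> X \<longleftrightarrow> f (p + t *\<^sub>R v) \<le> 0"
    using eventually_compose_filterlim[OF X] by simp
  have "((\<lambda>t. f (p + t *\<^sub>R v)) has_derivative (\<lambda>h. g \<bullet> (0 + h *\<^sub>R v))) (at 0)"
    by (rule has_derivative_compose[where g = f and f = "\<lambda>t. p + t *\<^sub>R v" and x = "0::real"])
       (use f in \<open>auto intro!: derivative_eq_intros\<close>)
  hence "((\<lambda>t. f (p + t *\<^sub>R v)) has_field_derivative (g \<bullet> v)) (at 0)"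
    by (rule has_derivative_imp_has_field_derivative) simp
  hence lim: "((\<lambda>t. f (p + t *\<^sub>R v) / t) \<longlongrightarrow> g \<bullet> v) (at_right 0)"
    using f(1) by (auto simp: has_field_derivative_iff intro: filterlim_mono at_le)
  have pos: "\<forall>\<^sub>F t::real in at_right 0. t > 0"
    by (simp add: eventually_at_right_less)
  show "\<forall>\<^sub>F t in at_right 0. p + t *\<^sub>R v \<notin> X" if "g \<bullet> v > 0"
    using order_tendstoD(1)[OF lim that] ev pos
    by eventually_elim (auto simp: field_simps zero_less_divide_iff)
  show "\<forall>\<^sub>F t in at_right 0. p + t *\<^sub>R v \<in> X" if "g \<bullet> v < 0"
    using order_tendstoD(2)[OF lim that] ev pos
    by eventually_elim (auto simp: field_simps divide_less_0_iff)
qed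

text \<open>The half-space \<open>g \<bullet> v > 0\<close> lies in
  \<open>h \<bullet> v \<ge> 0\<close>, because otherwise a short ray would be both inside and
  outside \<open>X\<close>. Such an inclusion forces the two normals to be positively
  proportional.\<close>

lemma outer_normal_unique:
  assumes "outer_normal X p g" "outer_normal X p h"
  shows "\<exists>c>0. h = c *\<^sub>R g"
proof -
  have nz: "g \<noteq> 0" "h \<noteq> 0"
    using assms by (auto simp: outer_normal_def)
  have side: "h \<bullet> v \<ge> 0" if "g \<bullet> v > 0" for v
  proof (rule ccontr)
    assume "\<not> h \<bullet> v \<ge> 0"
    hence "\<forall>\<^sub>F t in at_right 0. p + t *\<^sub>R v \<in> X"
      using outer_normal_ray(2)[OF assms(2)] by simp
    with outer_normal_ray(1)[OF assms(1) that] have "\<forall>\<^sub>F t in at_right (0::real). False"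
      by eventually_elim simp
    thus False by simp
  qed
  \<comment> \<open>\<open>c *\<^sub>R g\<close> is the orthogonal projection of \<open>h\<close> to
    the line of \<open>g\<close>; the remainder \<open>w\<close> is to be shown zero.\<close>
  define c where "c = (h \<bullet> g) / (g \<bullet> g)"
  define w where "w = h - c *\<^sub>R g"
  have wg: "w \<bullet> g = 0" and h: "h = c *\<^sub>R g + w"
    using nz by (auto simp: w_def c_def inner_diff_left)
  have c0: "c \<ge> 0"
    using side[of g] nz by (simp add: c_def)
  have "w \<bullet> w \<le> 0 + e" if "e > 0" for e
  proof -
    \<comment> \<open>The test vector \<open>\<epsilon> *\<^sub>R g - w\<close> lies in the
      half-space of \<open>g\<close> for every positive \<open>\<epsilon>\<close>. Using
      \<open>c + 1\<close> keeps the denominator nonzero when \<open>c = 0\<close>.\<close>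
    define \<epsilon> where "\<epsilon> = e / ((c + 1) * (g \<bullet> g))"
    have \<epsilon>: "\<epsilon> > 0"
      using that nz c0 by (simp add: \<epsilon>_def)
    have "g \<bullet> (\<epsilon> *\<^sub>R g - w) > 0"
      using \<epsilon> nz wg by (simp add: inner_diff_right inner_commute[of g w])
    from side[OF this] have "w \<bullet> w \<le> c * \<epsilon> * (g \<bullet> g)"
      using wg by (simp add: h inner_diff_right inner_add_left inner_commute[of g w] algebra_simps)
    also have "\<dots> \<le> (c + 1) * \<epsilon> * (g \<bullet> g)"
      using \<epsilon> by (intro mult_right_mono) auto
    also have "\<dots> = \<epsilon> * ((c + 1) * (g \<bullet> g))"
      by simp
    also have "\<dots> = e"
      using nz c0 unfolding \<epsilon>_def by (intro nonzero_eq_divide_eq[THEN iffD1]) auto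
    finally show ?thesis by simp
  qed
  hence "w \<bullet> w \<le> 0"
    by (rule field_le_epsilon)
  hence "w = 0"
    by (metis inner_eq_zero_iff inner_ge_zero order_antisym)
  hence "h = c *\<^sub>R g" "c \<noteq> 0"
    using h nz by auto
  thus ?thesis using c0 by (intro exI[of _ c]) auto
qed

lemma local_defining_function_differentiable:
  assumes "local_defining_function X p U f" "x \<in> U"
  shows "(f has_derivative frechet_derivative f (at x)) (at x)"
proof -
  have "Ck_on (Suc 0) f U"
    using assms(1) unfolding local_defining_function_def smooth_on_def by blast
  thus ?thesis
    using assms(2) by (simp add: frechet_derivative_works)
qed

lemma local_defining_function_outer_normal:
  assumes "local_defining_function X p U f"
  shows "\<exists>g. outer_normal X p g \<and> (\<forall>v. frechet_derivative f (at p) v = g \<bullet> v)"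
proof -
  let ?D = "frechet_derivative f (at p)"
  have U: "open U" "p \<in> U" "f p = 0" "\<exists>v. ?D v \<noteq> 0" "X \<inter> U = {x \<in> U. f x \<le> 0}"
    using assms unfolding local_defining_function_def by auto
  have D: "(f has_derivative ?D) (at p)"
    using local_defining_function_differentiable[OF assms U(2)] .
  \<comment> \<open>The adjoint of a linear functional, evaluated at 1, is its gradient.\<close>
  define g where "g = adjoint ?D 1"
  have g: "?D v = g \<bullet> v" for v
    using adjoint_works[OF has_derivative_linear[OF D], of v 1]
    by (simp add: g_def inner_commute)
  have "\<forall>\<^sub>F x in nhds p. x \<in> U"
    using U by (simp add: eventually_nhds_in_open)
  hence "\<forall>\<^sub>F x in nhds p. x \<in> X \<longleftrightarrow> f x \<le> 0"
    by eventually_elim (use U(5) in blast)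
  moreover have "(f has_derivative (\<lambda>v. g \<bullet> v)) (at p)"
    using D g by (metis (no_types, lifting) ext)
  moreover have "g \<noteq> 0"
    using U(4) g by auto
  ultimately show ?thesis
    unfolding outer_normal_def using U(3) g by blast
qed

text \<open>Only \<open>f q = 0\<close> has to be checked: where \<open>f\<close> is negative it
  stays negative nearby, which would make \<open>q\<close> an interior point.\<close>

lemma local_defining_function_frontier:
  assumes "local_defining_function X p U f" "closed X" "q \<in> frontier X" "q \<in> U"
  shows "local_defining_function X q U f"
proof -
  have U: "open U" "X \<inter> U = {x \<in> U. f x \<le> 0}"
    using assms(1) unfolding local_defining_function_def by auto
  have cont: "continuous_on U f"
    using has_derivative_continuous[OF local_defining_function_differentiable[OF assms(1)]]
    by (auto intro: continuous_at_imp_continuous_on)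
  have "f q \<le> 0"
    using assms(2-4) U(2) frontier_subset_closed by blast
  moreover have False if "f q < 0"
  proof -
    have "q \<in> U \<inter> f -` {..<0}"
      using assms(4) that by auto
    moreover have "open (U \<inter> f -` {..<0})"
      by (rule continuous_open_preimage[OF cont U(1) open_lessThan])
    moreover have "U \<inter> f -` {..<0} \<subseteq> X"
    proof -
      have "U \<inter> f -` {..<0} \<subseteq> {x \<in> U. f x \<le> 0}"
        by auto
      thus ?thesis
        unfolding U(2)[symmetric] by blast
    qed
    ultimately have "q \<in> interior X"
      by (metis interiorI)
    thus ?thesis
      using assms(3) by (simp add: frontier_def)
  qed
  ultimately have "f q = 0"
    by argo
  thus ?thesis
    using assms(1,4) unfolding local_defining_function_def by auto
qed

text \<open>Gradients of different defining functions at \<open>p\<close> are proportional, so all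
  of them have the same kernel.\<close>

lemma boundary_tangent_space_eq:
  assumes "has_smooth_boundary X" "p \<in> frontier X" "outer_normal X p g"
  shows "boundary_tangent_space X p = {v. g \<bullet> v = 0}"
proof -
  have eq: "frechet_derivative f (at p) v = 0 \<longleftrightarrow> g \<bullet> v = 0"
    if f: "local_defining_function X p U f" for U f v
  proof -
    obtain h where h: "outer_normal X p h" "\<forall>v. frechet_derivative f (at p) v = h \<bullet> v"
      using local_defining_function_outer_normal[OF f] by blast
    obtain c where "c > 0" "h = c *\<^sub>R g"
      using outer_normal_unique[OF assms(3) h(1)] by blast
    thus ?thesis
      using h(2) by simp
  qed
  thus ?thesis
    using assms(1,2) unfolding boundary_tangent_space_def has_smooth_boundary_def by blast
qed

lemma points_outward_imp_inner_pos:
  assumes "points_outward X p v" "outer_normal X p g"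
  shows "g \<bullet> v > 0"
proof -
  obtain U f where f: "local_defining_function X p U f" "frechet_derivative f (at p) v > 0"
    using assms(1) unfolding points_outward_def by blast
  then obtain h where h: "outer_normal X p h" "\<forall>v. frechet_derivative f (at p) v = h \<bullet> v"
    using local_defining_function_outer_normal by blast
  then obtain c where "c > 0" "h = c *\<^sub>R g"
    using outer_normal_unique[OF assms(2)] by blast
  thus ?thesis
    using f h by (simp add: zero_less_mult_iff)
qed

text \<open>The map \<open>A\<close> is orthogonal with inverse \<open>B\<close>, so
  \<open>\<lambda>x. f (B x)\<close> has gradient \<open>A g\<close> at \<open>A p\<close>.\<close>

lemma outer_normal_linear_image:
  fixes A B :: "'a::euclidean_space \<Rightarrow> 'a"
  assumes "outer_normal X p g" and B: "bounded_linear B"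
    and AB: "\<And>x. A (B x) = x" "\<And>x. B (A x) = x"
    and adj: "\<And>u v. A u \<bullet> v = u \<bullet> B v"
    and X: "\<And>x. B x \<in> X \<longleftrightarrow> x \<in> X"
  shows "outer_normal X (A p) (A g)"
proof -
  obtain f where g: "g \<noteq> 0" and f: "f p = 0" "(f has_derivative (\<lambda>v. g \<bullet> v)) (at p)"
    and ev: "\<forall>\<^sub>F x in nhds p. x \<in> X \<longleftrightarrow> f x \<le> (0::real)"
    using assms(1) unfolding outer_normal_def by blast
  have "A g \<noteq> 0"
    using g AB(2) linear_0[OF bounded_linear.linear[OF B]] by metis
  moreover have "((\<lambda>x. f (B x)) has_derivative (\<lambda>v. A g \<bullet> v)) (at (A p))"
    unfolding adj by (rule has_derivative_compose[where g = f and f = B])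
       (use f(2) AB(2) bounded_linear_imp_has_derivative[OF B] in auto)
  moreover have "\<forall>\<^sub>F x in nhds (A p). x \<in> X \<longleftrightarrow> f (B x) \<le> 0"
  proof -
    have "filterlim B (nhds (B (A p))) (nhds (A p))"
      using linear_continuous_at[OF B] by (simp add: continuous_at tendsto_nhds_iff)
    from eventually_compose_filterlim[OF _ this] ev AB(2) X show ?thesis
      by fastforce
  qed
  ultimately show ?thesis
    unfolding outer_normal_def using f(1) AB(2)
    by (intro conjI exI[of _ "\<lambda>x. f (B x)"]) auto
qed

subsection \<open>The torus action\<close>

definition torus_action :: "real^'n \<Rightarrow> complex^'n \<Rightarrow> complex^'n" where
  "torus_action s z = (\<chi> j. cis (s$j) * z$j)"

text \<open>The infinitesimal generator of the torus action in direction \<open>b\<close>.\<close>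

definition torus_field :: "real^'n \<Rightarrow> complex^'n \<Rightarrow> complex^'n" where
  "torus_field b z = (\<chi> j. \<i> * complex_of_real (b$j) * z$j)"

text \<open>The standard complex structure J, as a real linear map.\<close>

definition cstruct :: "complex^'n \<Rightarrow> complex^'n" where
  "cstruct z = (\<chi> j. \<i> * z$j)"

lemma torus_action_nth [simp]: "torus_action s z $ j = cis (s$j) * z$j"
  by (simp add: torus_action_def)

lemma torus_field_nth [simp]: "torus_field b z $ j = \<i> * complex_of_real (b$j) * z$j"
  by (simp add: torus_field_def)

lemma cstruct_nth [simp]: "cstruct z $ j = \<i> * z$j"
  by (simp add: cstruct_def)

lemma torus_action_add: "torus_action s (torus_action t z) = torus_action (s + t) z"
  by (simp add: vec_eq_iff cis_mult flip: mult.assoc)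

lemma torus_action_0 [simp]: "torus_action 0 z = z"
  by (simp add: vec_eq_iff)

lemma bounded_linear_torus_action: "bounded_linear (torus_action s)"
  unfolding linear_conv_bounded_linear[symmetric]
  by (rule linearI) (simp_all add: vec_eq_iff algebra_simps)

lemma bounded_linear_cstruct: "bounded_linear (cstruct :: complex^'n \<Rightarrow> complex^'n)"
  unfolding linear_conv_bounded_linear[symmetric]
  by (rule linearI) (simp_all add: vec_eq_iff algebra_simps)

lemma inner_torus_action: "torus_action s u \<bullet> v = u \<bullet> torus_action (- s) v"
  unfolding inner_vec_def by (rule sum.cong) (simp_all add: inner_complex_def algebra_simps)

lemma norm_torus_action [simp]: "norm (torus_action s z) = norm z"
  by (simp add: norm_eq_sqrt_inner inner_torus_action torus_action_add)

lemma inner_cstruct_left: "cstruct u \<bullet> v = - (u \<bullet> cstruct v)"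
  unfolding inner_vec_def sum_negf[symmetric]
  by (rule sum.cong) (simp_all add: inner_complex_def)

lemma cstruct_cstruct [simp]: "cstruct (cstruct z) = - z"
  by (simp add: vec_eq_iff)

lemma cstruct_scaleR [simp]: "cstruct (c *\<^sub>R z) = c *\<^sub>R cstruct z"
  by (simp add: vec_eq_iff)

lemma torus_action_scaleR: "torus_action s (c *\<^sub>R z) = c *\<^sub>R torus_action s z"
  by (simp add: vec_eq_iff)

lemma torus_action_cstruct: "torus_action s (cstruct z) = cstruct (torus_action s z)"
  by (simp add: vec_eq_iff algebra_simps)

lemma torus_action_field: "torus_action s (torus_field b z) = torus_field b (torus_action s z)"
  by (simp add: vec_eq_iff algebra_simps)

text \<open>Each coordinate is rotated by the difference of the arguments; where it vanishes any
  angle works.\<close>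

lemma torus_orbit:
  assumes "\<And>j. cmod (z$j) = cmod (w$j)"
  obtains s where "w = torus_action s z"
proof
  have polar: "complex_of_real (cmod x) * cis (Arg x) = x" for x
    using rcis_cmod_Arg[of x] by (simp add: rcis_def)
  have "w$j = cis (Arg (w$j) - Arg (z$j)) * z$j" for j
  proof -
    have "cis (Arg (w$j) - Arg (z$j)) * (complex_of_real (cmod (z$j)) * cis (Arg (z$j)))
      = complex_of_real (cmod (w$j)) * cis (Arg (w$j))"
      using assms[of j] by (simp add: cis_mult mult.left_commute)
    thus ?thesis by (simp only: polar)
  qed
  thus "w = torus_action (\<chi> j. Arg (w$j) - Arg (z$j)) z"
    by (simp add: vec_eq_iff)
qed

lemma torus_curve_has_derivative:
  "((\<lambda>t. torus_action (t *\<^sub>R b) p) has_derivative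
     (\<lambda>h. torus_action (t *\<^sub>R b) (torus_field (h *\<^sub>R b) p))) (at t)"
proof -
  have "((\<lambda>t. cis (t * b$j) * p$j) has_derivative
      (\<lambda>h. cis (t * b$j) * (\<i> * complex_of_real (h * b$j) * p$j))) (at t)" for j
    by (auto intro!: derivative_eq_intros simp: scaleR_conv_of_real algebra_simps)
  thus ?thesis
    by (subst has_derivative_componentwise_within)
       (auto simp: Basis_vec_def inner_axis intro!: has_derivative_inner_left)
qed

lemma torus_curve_has_vector_derivative:
  "((\<lambda>t. torus_action (t *\<^sub>R b) p) has_vector_derivative
     torus_action (t *\<^sub>R b) (torus_field b p)) (at t)"
proof -
  have "torus_action (t *\<^sub>R b) (torus_field (h *\<^sub>R b) p)
    = h *\<^sub>R torus_action (t *\<^sub>R b) (torus_field b p)" for h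
    by (simp add: vec_eq_iff) (simp add: scaleR_conv_of_real)
  thus ?thesis
    using torus_curve_has_derivative[of b p t] by (simp add: has_vector_derivative_def)
qed

text \<open>The derivative in direction \<open>h\<close> is again a torus curve, now through
  \<open>torus_field (h *\<^sub>R b) p\<close>. Hence the induction on \<open>k\<close> with
  \<open>p\<close> arbitrary.\<close>

lemma smooth_on_torus_curve: "smooth_on (\<lambda>t. torus_action (t *\<^sub>R b) p) UNIV"
proof -
  have "Ck_on k (\<lambda>t. torus_action (t *\<^sub>R b) p) UNIV" for k
  proof (induction k arbitrary: p)
    case 0
    show ?case
      using has_derivative_continuous[OF torus_curve_has_derivative]
      by (auto simp: continuous_on_eq_continuous_at)
  next
    case (Suc k)
    have "frechet_derivative (\<lambda>t. torus_action (t *\<^sub>R b) p) (at t)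
      = (\<lambda>h. torus_action (t *\<^sub>R b) (torus_field (h *\<^sub>R b) p))" for t
      using frechet_derivative_at[OF torus_curve_has_derivative] by metis
    thus ?case
      using Suc torus_curve_has_derivative unfolding differentiable_def Ck_on.simps by fastforce
  qed
  thus ?thesis
    by (simp add: smooth_on_def)
qed

subsection \<open>The Reeb vector field of the Liouville form\<close>

lemma liouville_form_eq: "liouville_form u v = (1/2) * (cstruct u \<bullet> v)"
  unfolding liouville_form_def inner_vec_def
  by (simp add: inner_complex_def add.commute)

text \<open>The form is linear in its base point, hence equal to its own derivative there;
  antisymmetry of J then cancels the factor 1/2. The result is the standard symplectic form.\<close>

lemma exterior_derivative_liouville_form:
  "exterior_derivative liouville_form p u v = cstruct u \<bullet> v"
proof -
  have "((\<lambda>x. liouville_form x w) has_derivative (\<lambda>x. liouville_form x w)) (at p)" for w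
    unfolding liouville_form_eq
    by (intro bounded_linear_imp_has_derivative bounded_linear_const_mult
        bounded_linear_compose[OF bounded_linear_inner_left bounded_linear_cstruct])
  hence D: "frechet_derivative (\<lambda>x. liouville_form x w) (at p) = (\<lambda>x. liouville_form x w)" for w
    using frechet_derivative_at by metis
  have "cstruct v \<bullet> u = - (cstruct u \<bullet> v)"
    by (metis inner_cstruct_left inner_commute)
  thus ?thesis
    unfolding exterior_derivative_def D by (simp add: liouville_form_eq)
qed

text \<open>On the hyperplane orthogonal to \<open>g\<close> the symplectic form degenerates exactly
  along \<open>cstruct g\<close>, and the Liouville form takes the value
  \<open>(g \<bullet> p) / 2\<close> on that vector.\<close>

lemma Reeb_vector_field_eq:
  fixes X :: "(complex^'n) set"
  assumes "has_smooth_boundary X" "p \<in> frontier X" "outer_normal X p g" "g \<bullet> p > 0"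
  shows "Reeb_vector_field X liouville_form p = (2 / (g \<bullet> p)) *\<^sub>R cstruct g"
  unfolding Reeb_vector_field_def boundary_tangent_space_eq[OF assms(1-3)]
    exterior_derivative_liouville_form liouville_form_eq
proof (rule the_equality)
  have "g \<bullet> cstruct g = 0"
    using inner_cstruct_left[of g g] by (simp add: inner_commute)
  moreover have "cstruct p \<bullet> cstruct g = g \<bullet> p"
    by (simp add: inner_cstruct_left inner_commute)
  ultimately show "(2 / (g \<bullet> p)) *\<^sub>R cstruct g \<in> {v. g \<bullet> v = 0} \<and>
    (\<forall>v\<in>{v. g \<bullet> v = 0}. cstruct ((2 / (g \<bullet> p)) *\<^sub>R cstruct g) \<bullet> v = 0) \<and>
    1 / 2 * (cstruct p \<bullet> (2 / (g \<bullet> p)) *\<^sub>R cstruct g) = 1"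
    using assms(4) by auto
next
  fix R
  assume R: "R \<in> {v. g \<bullet> v = 0} \<and> (\<forall>v\<in>{v. g \<bullet> v = 0}. cstruct R \<bullet> v = 0) \<and>
    1 / 2 * (cstruct p \<bullet> R) = 1"
  have g: "g \<noteq> 0"
    using assms(4) by auto
  \<comment> \<open>\<open>cstruct R\<close> is orthogonal to everything orthogonal to
    \<open>g\<close>, so it equals its projection \<open>c *\<^sub>R g\<close>; applying J once more
    recovers \<open>R\<close>.\<close>
  define c where "c = (cstruct R \<bullet> g) / (g \<bullet> g)"
  define w where "w = cstruct R - c *\<^sub>R g"
  have "g \<bullet> w = 0"
    using g by (simp add: w_def c_def inner_diff_right inner_commute)
  hence "w \<bullet> w = 0"
    using R by (simp add: w_def inner_diff_left)
  hence "cstruct R = c *\<^sub>R g"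
    by (simp add: w_def)
  hence "cstruct (cstruct R) = c *\<^sub>R cstruct g"
    by simp
  hence Rg: "R = (- c) *\<^sub>R cstruct g"
    by (metis cstruct_cstruct minus_equation_iff scaleR_minus_left)
  moreover have "cstruct p \<bullet> cstruct g = g \<bullet> p"
    by (simp add: inner_cstruct_left inner_commute)
  ultimately have "- c * (g \<bullet> p) = 2"
    using R by simp
  hence "- c = 2 / (g \<bullet> p)"
    using assms(4) by (simp add: field_simps)
  thus "R = (2 / (g \<bullet> p)) *\<^sub>R cstruct g"
    using Rg by simp
qed

subsection \<open>Starshaped domains invariant under the torus\<close>

locale toric_starshaped =
  fixes X :: "(complex^'n) set"
  assumes starshaped: "smooth_compact_starshaped X"
    and torus_invariant: "\<And>s z. z \<in> X \<Longrightarrow> torus_action s z \<in> X"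
begin

abbreviation "Reeb \<equiv> Reeb_vector_field X liouville_form"

abbreviation "orbit \<equiv> periodic_Reeb_orbit X liouville_form"

section \<open>Equivariance of the boundary, its normals and the Reeb field\<close>

lemma torus_invariant_iff: "torus_action s z \<in> X \<longleftrightarrow> z \<in> X"
  using torus_invariant[of z s] torus_invariant[of "torus_action s z" "- s"]
  by (auto simp: torus_action_add)

text \<open>The action is by isometries that preserve both \<open>X\<close> and its
  complement.\<close>

lemma frontier_invariant:
  assumes "p \<in> frontier X"
  shows "torus_action s p \<in> frontier X"
proof -
  have "dist (torus_action s p) (torus_action s x) = dist p x" for x
    using linear_diff[OF bounded_linear.linear[OF bounded_linear_torus_action], of s p x, symmetric]
    by (simp add: dist_norm)
  thus ?thesis
    using assms unfolding frontier_straddle by (metis torus_invariant_iff)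
qed

lemma outer_normal_inner_pos:
  assumes "p \<in> frontier X" "outer_normal X p g"
  shows "g \<bullet> p > 0"
  using starshaped assms points_outward_imp_inner_pos
  unfolding smooth_compact_starshaped_def by blast

lemma outer_normal_exists:
  assumes "p \<in> frontier X"
  obtains g where "outer_normal X p g"
  using starshaped assms local_defining_function_outer_normal
  unfolding smooth_compact_starshaped_def has_smooth_boundary_def by metis

lemma Reeb_eq:
  assumes "p \<in> frontier X" "outer_normal X p g"
  shows "Reeb p = (2 / (g \<bullet> p)) *\<^sub>R cstruct g"
  using starshaped Reeb_vector_field_eq[OF _ assms outer_normal_inner_pos[OF assms]]
  unfolding smooth_compact_starshaped_def by blast

lemma outer_normal_torus_action:
  assumes "outer_normal X p g"
  shows "outer_normal X (torus_action s p) (torus_action s g)"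
  by (rule outer_normal_linear_image[OF assms bounded_linear_torus_action[of "- s"]])
     (simp_all add: torus_action_add inner_torus_action torus_invariant_iff)

text \<open>The action carries normals to normals, commutes with J and preserves
  \<open>g \<bullet> p\<close>.\<close>

lemma Reeb_torus_action:
  assumes "p \<in> frontier X"
  shows "Reeb (torus_action s p) = torus_action s (Reeb p)"
proof -
  obtain g where g: "outer_normal X p g"
    using outer_normal_exists[OF assms] .
  show ?thesis
    unfolding Reeb_eq[OF assms g]
      Reeb_eq[OF frontier_invariant[OF assms] outer_normal_torus_action[OF g]]
    by (simp add: inner_torus_action torus_action_add torus_action_scaleR torus_action_cstruct)
qed

section \<open>The Reeb field as a generator of the torus action\<close>

text \<open>The torus curve through \<open>p\<close> stays in \<open>X\<close>, so along it
  \<open>f\<close> has a local maximum 0 at time 0.\<close>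

lemma outer_normal_orthogonal_torus_field:
  assumes "p \<in> X" "outer_normal X p g"
  shows "g \<bullet> torus_field b p = 0"
proof -
  obtain f where f: "f p = 0" "(f has_derivative (\<lambda>v. g \<bullet> v)) (at p)"
    and X: "\<forall>\<^sub>F x in nhds p. x \<in> X \<longleftrightarrow> f x \<le> (0::real)"
    using assms(2) unfolding outer_normal_def by blast
  let ?c = "\<lambda>t. torus_action (t *\<^sub>R b) p"
  have c: "(?c has_derivative (\<lambda>h. h *\<^sub>R torus_field b p)) (at 0)"
    using torus_curve_has_vector_derivative[of b p 0] by (simp add: has_vector_derivative_def)
  have "((\<lambda>t. f (?c t)) has_derivative (\<lambda>h. g \<bullet> (h *\<^sub>R torus_field b p))) (at 0)"
    by (rule has_derivative_compose[where g = f and f = ?c, OF c]) (simp add: f)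
  hence D: "((\<lambda>t. f (?c t)) has_field_derivative (g \<bullet> torus_field b p)) (at 0)"
    by (rule has_derivative_imp_has_field_derivative) simp
  have "filterlim ?c (nhds p) (at 0)"
    using has_derivative_continuous[OF c] by (simp add: continuous_at)
  hence "filterlim ?c (nhds p) (nhds 0)"
    by (simp add: tendsto_nhds_iff)
  from eventually_compose_filterlim[OF X this] obtain d
    where d: "d > 0" "\<And>t. dist t 0 < d \<Longrightarrow> ?c t \<in> X \<longleftrightarrow> f (?c t) \<le> 0"
    unfolding eventually_nhds_metric by blast
  show ?thesis
    by (rule DERIV_local_max[OF D d(1)]) (use d(2) assms(1) f(1) torus_invariant in \<open>auto simp: dist_real_def\<close>)
qed

text \<open>Where \<open>p$j = 0\<close>, rotating the \<open>j\<close>-th coordinate by \<open>pi\<close> fixes \<open>p\<close>, hence also the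
  outer normal, whose \<open>j\<close>-th component must therefore vanish.\<close>

lemma outer_normal_nth:
  assumes "p \<in> X" "outer_normal X p g"
  obtains a :: real where "g $ j = of_real a * p $ j"
proof (cases "p $ j = 0")
  case True
  define s :: "real^'n" where "s = axis j pi"
  have "torus_action s p = p"
    using True by (simp add: vec_eq_iff s_def axis_def)
  then obtain c where c: "c > 0" "torus_action s g = c *\<^sub>R g"
    using outer_normal_torus_action[OF assms(2), of s] outer_normal_unique[OF assms(2)] by metis
  have "norm g = c * norm g"
    using c norm_torus_action[of s g] by simp
  hence "c = 1"
    using assms(2) by (simp add: outer_normal_def)
  hence "torus_action s g $ j = g $ j"
    using c by simp
  hence "g $ j = 0"
    by (simp add: s_def)
  thus ?thesis
    using that[of 0] by simp
next
  case False
  \<comment> \<open>Rotating only the \<open>j\<close>-th coordinate shows that \<open>g$j\<close>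
    is orthogonal to \<open>\<i> * p$j\<close>, so the ratio \<open>g$j / p$j\<close> is
    real.\<close>
  have "torus_field (axis j 1) p = axis j (\<i> * p$j)"
    by (simp add: vec_eq_iff axis_def)
  hence "g$j \<bullet> (\<i> * p$j) = 0"
    using outer_normal_orthogonal_torus_field[OF assms, of "axis j 1"] by (simp add: inner_axis)
  hence "Im (g$j / p$j) = 0"
    by (simp add: Im_divide inner_complex_def)
  hence "g$j = of_real (Re (g$j / p$j)) * p$j"
    using False by (metis complex_is_Real_iff nonzero_divide_eq_eq of_real_Re)
  thus ?thesis
    using that by blast
qed

lemma frontier_subset: "frontier X \<subseteq> X"
  using starshaped unfolding smooth_compact_starshaped_def
  by (simp add: compact_imp_closed frontier_subset_closed)

lemma Reeb_eq_torus_field: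
  assumes "p \<in> frontier X"
  obtains b where "Reeb p = torus_field b p"
proof -
  obtain g where g: "outer_normal X p g"
    using outer_normal_exists[OF assms] .
  have "\<forall>j. \<exists>a::real. g $ j = of_real a * p $ j"
    using outer_normal_nth[OF _ g] assms frontier_subset by blast
  then obtain a :: "'n \<Rightarrow> real" where a: "\<And>j. g $ j = of_real (a j) * p $ j"
    by metis
  have "Reeb p = torus_field (\<chi> j. (2 / (g \<bullet> p)) * a j) p"
    by (simp add: Reeb_eq[OF assms g] vec_eq_iff) (simp add: a scaleR_conv_of_real algebra_simps)
  thus ?thesis
    using that by blast
qed

section \<open>Closed Reeb orbits as torus curves\<close>

lemma Reeb_torus_orbit:
  assumes "p \<in> frontier X" "Reeb p = torus_field b p"
  shows "Reeb (torus_action s p) = torus_field b (torus_action s p)"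
  using assms by (simp add: Reeb_torus_action torus_action_field)

lemma periodic_Reeb_orbit_torus_curve:
  assumes "p \<in> frontier X" "Reeb p = torus_field b p"
    and "\<tau> > 0" "torus_action (\<tau> *\<^sub>R b) p = p"
  shows "orbit \<tau> (\<lambda>t. torus_action (t *\<^sub>R b) p)"
  unfolding periodic_Reeb_orbit_def
proof (intro conjI allI)
  show "torus_action ((t + \<tau>) *\<^sub>R b) p = torus_action (t *\<^sub>R b) p" for t
    by (metis assms(4) scaleR_left_distrib torus_action_add)
  show "((\<lambda>t. torus_action (t *\<^sub>R b) p) has_vector_derivative
    Reeb (torus_action (t *\<^sub>R b) p)) (at t)" for t
    using torus_curve_has_vector_derivative[of b p t]
    by (simp add: Reeb_torus_orbit[OF assms(1,2)] torus_action_field)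
qed (use assms in \<open>auto simp: smooth_on_torus_curve frontier_invariant\<close>)

text \<open>The Reeb field is tangent to torus orbits, so the moduli of the coordinates are constant
  and \<open>\<gamma>\<close> stays on one torus orbit, where the speeds \<open>b\<close> apply
  throughout. Undoing the rotation then leaves a curve with zero derivative.\<close>

lemma periodic_Reeb_orbit_eq_torus_curve:
  assumes "orbit \<tau> \<gamma>" "Reeb (\<gamma> 0) = torus_field b (\<gamma> 0)"
  shows "\<gamma> t = torus_action (t *\<^sub>R b) (\<gamma> 0)"
proof -
  have fr: "\<gamma> t \<in> frontier X" and D: "(\<gamma> has_vector_derivative Reeb (\<gamma> t)) (at t)" for t
    using assms(1) by (auto simp: periodic_Reeb_orbit_def)
  have Dj: "((\<lambda>t. \<gamma> t $ j) has_vector_derivative Reeb (\<gamma> t) $ j) (at t)" for t j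
    using bounded_linear.has_vector_derivative[OF bounded_linear_vec_nth D] .
  have "cmod (\<gamma> 0 $ j) = cmod (\<gamma> t $ j)" for t j
  proof -
    have "((\<lambda>t. \<gamma> t $ j \<bullet> \<gamma> t $ j) has_field_derivative 0) (at t)" for t
    proof -
      obtain b' where b': "Reeb (\<gamma> t) = torus_field b' (\<gamma> t)"
        using Reeb_eq_torus_field[OF fr] .
      have "\<gamma> t $ j \<bullet> (Reeb (\<gamma> t) $ j) = 0"
        unfolding b' by (simp add: inner_complex_def)
      hence "((\<lambda>t. \<gamma> t $ j \<bullet> \<gamma> t $ j) has_derivative (\<lambda>h. h * 0)) (at t)"
        using has_derivative_inner[OF Dj[where j = j and t = t, unfolded has_vector_derivative_def]
          Dj[where j = j and t = t, unfolded has_vector_derivative_def]]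
        by (simp add: inner_commute)
      thus ?thesis
        by (simp add: has_field_derivative_def lambda_zero)
    qed
    hence "\<gamma> 0 $ j \<bullet> \<gamma> 0 $ j = \<gamma> t $ j \<bullet> \<gamma> t $ j"
      using DERIV_isconst_all by blast
    thus ?thesis
      by (simp add: norm_eq_sqrt_inner)
  qed
  hence R: "Reeb (\<gamma> t) = torus_field b (\<gamma> t)" for t
    using torus_orbit[of "\<gamma> 0" "\<gamma> t"] Reeb_torus_orbit[OF fr assms(2)] by metis
  have "cis (- (t * b$j)) * \<gamma> t $ j = \<gamma> 0 $ j" for j t
  proof -
    have "((\<lambda>t. cis (- (t * b$j)) * \<gamma> t $ j) has_derivative (\<lambda>h. 0)) (at t)" for t
      using Dj[where j = j and t = t, unfolded has_vector_derivative_def R]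
      by (auto intro!: derivative_eq_intros simp: scaleR_conv_of_real algebra_simps)
    hence "\<exists>c. \<forall>t. cis (- (t * b$j)) * \<gamma> t $ j = c"
      using has_derivative_zero_constant[of UNIV "\<lambda>t. cis (- (t * b$j)) * \<gamma> t $ j"] by auto
    thus ?thesis
      by (metis cis_zero mult_1 mult_zero_left neg_equal_0_iff_equal)
  qed
  hence "torus_action (- (t *\<^sub>R b)) (\<gamma> t) = \<gamma> 0"
    by (simp add: vec_eq_iff)
  thus ?thesis
    by (metis add.right_inverse torus_action_0 torus_action_add)
qed

section \<open>Bounds on the rotation speeds\<close>

text \<open>Along the rotation \<open>c\<close> of the \<open>j\<close>-th coordinate, \<open>f\<close> is critical in the direction
  \<open>axis j (\<i> * c t $ j)\<close>. Differentiating this relation in \<open>t\<close> expresses the rotation speed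
  \<open>b$j\<close> by second derivatives of \<open>f\<close>.\<close>

lemma rotation_speed_eq:
  fixes f :: "complex^'n \<Rightarrow> real" and j :: 'n
  defines "D \<equiv> \<lambda>v x. frechet_derivative f (at x) v"
  assumes f: "local_defining_function X p U f" and p: "p \<in> frontier X"
    and R: "Reeb p = torus_field b p"
  shows "Re (p$j) * frechet_derivative (D (axis j \<i>)) (at p) (axis j (\<i> * p$j))
      - Im (p$j) * frechet_derivative (D (axis j 1)) (at p) (axis j (\<i> * p$j))
      = D p p * b$j / 2 * (cmod (p$j))\<^sup>2"
proof -
  define x y where "x = Re (p$j)" and "y = Im (p$j)"
  define c where "c = (\<lambda>t::real. torus_action (t *\<^sub>R axis j 1) p)"
  define P Q where "P = D (axis j 1)" and "Q = D (axis j \<i>)"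
  define W :: "complex^'n" where "W = axis j (\<i> * p$j)"
  have U: "open U" "p \<in> U"
    using f by (auto simp: local_defining_function_def)
  have "Ck_on (Suc (Suc 0)) f U"
    using f unfolding local_defining_function_def smooth_on_def by blast
  hence diff: "(D v has_derivative frechet_derivative (D v) (at p)) (at p)" for v
    using U by (simp add: D_def frechet_derivative_works)
  have W: "torus_field (axis j 1) p = W"
    by (simp add: vec_eq_iff axis_def W_def)
  have c0: "c 0 = p"
    by (simp add: c_def)
  have c: "(c has_derivative (\<lambda>h. h *\<^sub>R W)) (at 0)"
    using torus_curve_has_vector_derivative[of "axis j 1" p 0]
    by (simp add: has_vector_derivative_def W c_def)
  have Dc: "((\<lambda>t. D v (c t)) has_field_derivative frechet_derivative (D v) (at p) W) (at 0)" for v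
  proof -
    have "((\<lambda>t. D v (c t)) has_derivative (\<lambda>h. frechet_derivative (D v) (at p) (h *\<^sub>R W))) (at 0)"
      by (rule has_derivative_compose[where g = "D v" and f = c, OF c]) (simp add: diff c0)
    thus ?thesis
      by (rule has_derivative_imp_has_field_derivative)
         (simp add: linear_cmul[OF has_derivative_linear[OF diff]])
  qed
  \<comment> \<open>Tangency of the torus orbit to the boundary, in real coordinates: the two
    trigonometric factors are the real and imaginary parts of \<open>c t $ j\<close>, and
    \<open>P\<close>, \<open>Q\<close> are the matching partial derivatives of
    \<open>f\<close>.\<close>
  have crit: "(cos t * x - sin t * y) * Q (c t) - (cos t * y + sin t * x) * P (c t) = 0"
    if "c t \<in> U" for t
  proof -
    have fr: "c t \<in> frontier X"
      by (simp add: c_def frontier_invariant p)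
    have "closed X"
      using starshaped by (simp add: smooth_compact_starshaped_def compact_imp_closed)
    from local_defining_function_outer_normal[OF
        local_defining_function_frontier[OF f this fr that]]
    obtain g where g: "outer_normal X (c t) g" "\<And>v. D v (c t) = g \<bullet> v"
      unfolding D_def by blast
    have "torus_field (axis j 1) (c t) = axis j (\<i> * (cis t * p$j))"
      by (simp add: vec_eq_iff axis_def c_def)
    hence "g$j \<bullet> (\<i> * (cis t * p$j)) = 0"
      using outer_normal_orthogonal_torus_field[OF _ g(1), of "axis j 1"] fr frontier_subset
      by (auto simp: inner_axis)
    thus ?thesis
      by (simp add: P_def Q_def g(2) inner_axis) (simp add: inner_complex_def x_def y_def algebra_simps)
  qed
  have DF: "((\<lambda>t. (cos t * x - sin t * y) * Q (c t) - (cos t * y + sin t * x) * P (c t))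
      has_field_derivative (- y * Q p + x * frechet_derivative Q (at p) W
        - (x * P p + y * frechet_derivative P (at p) W))) (at 0)"
    unfolding P_def Q_def by (auto intro!: derivative_eq_intros Dc simp: c0)
  have ev: "\<forall>\<^sub>F t in nhds 0. (cos t * x - sin t * y) * Q (c t) - (cos t * y + sin t * x) * P (c t) = 0"
  proof -
    have "filterlim c (nhds p) (at 0)"
      using has_derivative_continuous[OF c] by (simp add: continuous_at c0)
    hence "filterlim c (nhds p) (nhds 0)"
      by (simp add: tendsto_nhds_iff c0)
    with U have "\<forall>\<^sub>F t in nhds 0. c t \<in> U"
      using topological_tendstoD by blast
    thus ?thesis
      by eventually_elim (use crit in blast)
  qed
  have "((\<lambda>t::real. 0::real) has_field_derivative (- y * Q p + x * frechet_derivative Q (at p) W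
        - (x * P p + y * frechet_derivative P (at p) W))) (at 0)"
    by (rule DERIV_cong_ev[OF refl ev refl, THEN iffD1, OF DF])
  from DERIV_unique[OF this DERIV_const]
  have eq: "x * frechet_derivative Q (at p) W - y * frechet_derivative P (at p) W = x * P p + y * Q p"
    by simp
  obtain g where g: "outer_normal X p g" "\<And>v. D v p = g \<bullet> v"
    using local_defining_function_outer_normal[OF f] unfolding D_def by blast
  \<comment> \<open>Comparing the two expressions for the Reeb vector turns the first derivatives
    \<open>P p\<close> and \<open>Q p\<close> into multiples of \<open>b$j\<close>.\<close>
  have "(2 / (g \<bullet> p)) *\<^sub>R cstruct g $ j = \<i> * (of_real (b$j) * p$j)"
    using R Reeb_eq[OF p g(1)] by (metis vector_scaleR_component torus_field_nth mult.assoc)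
  hence "\<i> * ((2 / (g \<bullet> p)) *\<^sub>R g $ j) = \<i> * (of_real (b$j) * p$j)"
    by simp
  hence "(2 / (g \<bullet> p)) *\<^sub>R g $ j = of_real (b$j) * p$j"
    unfolding mult_cancel_left by simp
  hence "((g \<bullet> p) / 2) *\<^sub>R ((2 / (g \<bullet> p)) *\<^sub>R g $ j) = ((g \<bullet> p) / 2) *\<^sub>R (of_real (b$j) * p$j)"
    by (rule arg_cong)
  hence "g $ j = (g \<bullet> p * b$j / 2) *\<^sub>R p$j"
    using outer_normal_inner_pos[OF p g(1)] by (simp add: complex_eq_iff)
  hence PQ: "P p = g \<bullet> p * b$j / 2 * x" "Q p = g \<bullet> p * b$j / 2 * y"
    by (simp_all add: P_def Q_def g(2) inner_axis x_def y_def inner_complex_def)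
  have "x * frechet_derivative Q (at p) W - y * frechet_derivative P (at p) W
      = g \<bullet> p * b$j / 2 * (x\<^sup>2 + y\<^sup>2)"
    unfolding eq PQ by (simp add: algebra_simps power2_eq_square)
  thus ?thesis
    by (simp only: g(2) cmod_power2 x_def y_def W_def P_def Q_def)
qed

text \<open>Both sides of \<open>rotation_speed_eq\<close> are of second order in
  \<open>cmod (p$j)\<close>, so dividing by its square bounds \<open>b$j\<close> even as
  \<open>p$j\<close> tends to 0. At \<open>p$j = 0\<close> the speed is arbitrary, as it does not
  affect \<open>torus_field b p\<close>.\<close>

lemma rotation_speed_locally_bounded:
  assumes "p\<^sub>0 \<in> frontier X"
  shows "\<exists>V L. open V \<and> p\<^sub>0 \<in> V \<and>
    (\<forall>p\<in>V \<inter> frontier X. \<forall>b j. Reeb p = torus_field b p \<longrightarrow> p$j \<noteq> 0 \<longrightarrow> \<bar>b$j\<bar> \<le> L)"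
proof -
  obtain U f where f: "local_defining_function X p\<^sub>0 U f"
    using starshaped assms unfolding smooth_compact_starshaped_def has_smooth_boundary_def by blast
  have U: "open U" "p\<^sub>0 \<in> U"
    using f by (auto simp: local_defining_function_def)
  have cX: "closed X"
    using starshaped by (simp add: smooth_compact_starshaped_def compact_imp_closed)
  define D where "D = (\<lambda>v x. frechet_derivative f (at x) v)"
  define DD where "DD = (\<lambda>v w x. frechet_derivative (D v) (at x) w)"
  define h where "h = (\<lambda>x. D x x)"
  define M where "M = (\<lambda>x. \<Sum>v\<in>Basis. \<Sum>w\<in>Basis. \<bar>DD v w x\<bar>)"
  have Ck: "Ck_on k f U" for k
    using f unfolding local_defining_function_def smooth_on_def by blast
  have D_cont: "continuous_on U (D v)" for v
    using Ck[of "Suc 0"] by (simp add: D_def)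
  have DD_cont: "continuous_on U (DD v w)" for v w
    using Ck[of "Suc (Suc 0)"] by (simp add: D_def DD_def)
  have D_lin: "linear (\<lambda>v. D v x)" if "x \<in> U" for x
    using has_derivative_linear[OF local_defining_function_differentiable[OF f that]]
    by (simp add: D_def)
  have DD_lin: "linear (\<lambda>w. DD v w x)" if "x \<in> U" for v x
    using Ck[of "Suc (Suc 0)"] that unfolding DD_def
    by (auto simp: D_def intro!: linear_frechet_derivative)
  \<comment> \<open>Here \<open>x\<close> enters both as base point and as direction; expanding the
    direction in the basis yields continuity of \<open>h\<close>.\<close>
  have "h x = (\<Sum>b\<in>Basis. (x \<bullet> b) * D b x)" if "x \<in> U" for x
  proof -
    have "D (\<Sum>b\<in>Basis. (x \<bullet> b) *\<^sub>R b) x = (\<Sum>b\<in>Basis. (x \<bullet> b) * D b x)"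
      by (simp only: linear_sum[OF D_lin[OF that]] linear_cmul[OF D_lin[OF that]] real_scaleR_def)
    thus ?thesis
      by (simp only: h_def euclidean_representation)
  qed
  moreover have "continuous_on U (\<lambda>x. \<Sum>b\<in>Basis. (x \<bullet> b) * D b x)"
    by (intro continuous_intros D_cont)
  ultimately have h_cont: "continuous_on U h"
    by (simp cong: continuous_on_cong)
  have M_cont: "continuous_on U M"
    unfolding M_def by (intro continuous_intros DD_cont)
  have h_pos: "h p > 0" if pU: "p \<in> U" "p \<in> frontier X" for p
  proof -
    obtain g where "outer_normal X p g" "\<And>v. D v p = g \<bullet> v"
      using local_defining_function_outer_normal[OF
        local_defining_function_frontier[OF f cX pU(2,1)]] unfolding D_def by blast
    thus ?thesis
      using outer_normal_inner_pos[OF pU(2)] by (simp add: h_def)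
  qed
  define V where "V = U \<inter> h -` {0<..}"
  \<comment> \<open>One more than the value of the bound \<open>8 * M x / h x\<close> at
    \<open>p\<^sub>0\<close>, so that by continuity the bound stays below \<open>L\<close>
    nearby.\<close>
  define L where "L = 8 * M p\<^sub>0 / h p\<^sub>0 + 1"
  have V: "open V"
    unfolding V_def by (rule continuous_open_preimage[OF h_cont U(1) open_greaterThan])
  have "continuous_on V (\<lambda>x. 8 * M x / h x)"
    by (intro continuous_intros continuous_on_subset[OF h_cont] continuous_on_subset[OF M_cont])
       (auto simp: V_def)
  hence "open (V \<inter> (\<lambda>x. 8 * M x / h x) -` {..<L})"
    by (rule continuous_open_preimage[OF _ V open_lessThan])
  moreover have "p\<^sub>0 \<in> V \<inter> (\<lambda>x. 8 * M x / h x) -` {..<L}"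
    using U h_pos assms by (auto simp: V_def L_def)
  moreover have "\<bar>b$j\<bar> \<le> L"
    if p: "p \<in> (V \<inter> (\<lambda>x. 8 * M x / h x) -` {..<L}) \<inter> frontier X"
      and b: "Reeb p = torus_field b p" "p$j \<noteq> 0" for p b j
  proof -
    have pU: "p \<in> U" "p \<in> frontier X" "8 * M p / h p < L"
      using p by (auto simp: V_def)
    define x y r where "x = Re (p$j)" and "y = Im (p$j)" and "r = cmod (p$j)"
    have xy: "\<bar>x\<bar> \<le> r" "\<bar>y\<bar> \<le> r" and r: "r > 0"
      using b abs_Re_le_cmod abs_Im_le_cmod by (auto simp: x_def y_def r_def)
    have DD_le: "\<bar>DD v w p\<bar> \<le> M p" if "v \<in> Basis" "w \<in> Basis" for v w
    proof -
      have "\<bar>DD v w p\<bar> \<le> (\<Sum>w\<in>Basis. \<bar>DD v w p\<bar>)"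
        using that by (intro member_le_sum) auto
      also have "\<dots> \<le> M p"
        unfolding M_def using that
        by (intro member_le_sum[of v Basis "\<lambda>v. \<Sum>w\<in>Basis. \<bar>DD v w p\<bar>"]) (auto intro: sum_nonneg)
      finally show ?thesis .
    qed
    have ax: "axis j 1 \<in> (Basis :: (complex^'n) set)" "axis j \<i> \<in> (Basis :: (complex^'n) set)"
      by (auto simp: Basis_vec_def Basis_complex_def)
    have W: "axis j (\<i> * p$j) = (- y) *\<^sub>R axis j 1 + x *\<^sub>R axis j \<i>"
      by (auto simp: vec_eq_iff axis_def complex_eq_iff x_def y_def)
    have DD_W: "\<bar>DD v (axis j (\<i> * p$j)) p\<bar> \<le> 2 * r * M p" if "v \<in> Basis" for v
    proof -
      have "DD v (axis j (\<i> * p$j)) p = (- y) * DD v (axis j 1) p + x * DD v (axis j \<i>) p"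
        unfolding W by (simp only: linear_add[OF DD_lin[OF pU(1)]] linear_cmul[OF DD_lin[OF pU(1)]] real_scaleR_def)
      also have "\<bar>\<dots>\<bar> \<le> \<bar>y\<bar> * \<bar>DD v (axis j 1) p\<bar> + \<bar>x\<bar> * \<bar>DD v (axis j \<i>) p\<bar>"
        by (rule order_trans[OF abs_triangle_ineq]) (simp add: abs_mult)
      also have "\<dots> \<le> r * M p + r * M p"
        using xy r DD_le that ax by (intro add_mono mult_mono) auto
      finally show ?thesis by simp
    qed
    have "h p * b$j / 2 * r\<^sup>2
      = x * DD (axis j \<i>) (axis j (\<i> * p$j)) p - y * DD (axis j 1) (axis j (\<i> * p$j)) p"
      using rotation_speed_eq[OF local_defining_function_frontier[OF f cX pU(2,1)] pU(2) b(1), of j]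
      by (simp add: D_def DD_def h_def x_def y_def r_def)
    also have "\<bar>\<dots>\<bar> \<le> \<bar>x\<bar> * \<bar>DD (axis j \<i>) (axis j (\<i> * p$j)) p\<bar>
        + \<bar>y\<bar> * \<bar>DD (axis j 1) (axis j (\<i> * p$j)) p\<bar>"
      by (rule order_trans[OF abs_triangle_ineq4]) (simp add: abs_mult)
    also have "\<dots> \<le> r * (2 * r * M p) + r * (2 * r * M p)"
      using xy r DD_W ax by (intro add_mono mult_mono) auto
    \<comment> \<open>Two terms of size \<open>2 * r\<^sup>2 * M p\<close> against
      \<open>h p * b$j / 2 * r\<^sup>2\<close> give the constant 8.\<close>
    finally have "\<bar>b$j\<bar> * h p * r\<^sup>2 \<le> 8 * M p * r\<^sup>2"
      using h_pos[OF pU(1,2)] by (simp add: abs_mult power2_eq_square algebra_simps)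
    hence "\<bar>b$j\<bar> * h p \<le> 8 * M p"
      using r by simp
    hence "\<bar>b$j\<bar> \<le> 8 * M p / h p"
      using h_pos[OF pU(1,2)] by (simp add: field_simps)
    thus ?thesis
      using pU(3) by simp
  qed
  ultimately show ?thesis
    by (intro exI conjI) blast+
qed

text \<open>The boundary is compact, so finitely many local bounds suffice; the sum of their
  absolute values dominates each of them.\<close>

lemma rotation_speed_bounded:
  "\<exists>L. \<forall>p\<in>frontier X. \<forall>b j. Reeb p = torus_field b p \<longrightarrow> p$j \<noteq> 0 \<longrightarrow> \<bar>b$j\<bar> \<le> L"
proof -
  obtain V L where VL: "\<And>q. q \<in> frontier X \<Longrightarrow> open (V q)" "\<And>q. q \<in> frontier X \<Longrightarrow> q \<in> V q"
    "\<And>q p b j. q \<in> frontier X \<Longrightarrow> p \<in> V q \<inter> frontier X \<Longrightarrow> Reeb p = torus_field b p \<Longrightarrow>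
      p$j \<noteq> 0 \<Longrightarrow> \<bar>b$j\<bar> \<le> L q"
    using rotation_speed_locally_bounded by metis
  have "compact (frontier X)"
    using starshaped by (simp add: smooth_compact_starshaped_def compact_frontier)
  then obtain C where C: "C \<subseteq> frontier X" "finite C" "frontier X \<subseteq> (\<Union>q\<in>C. V q)"
    using compactE_image[of "frontier X" "frontier X" V] VL(1,2) by blast
  have "\<bar>b$j\<bar> \<le> (\<Sum>q\<in>C. \<bar>L q\<bar>)"
    if p: "p \<in> frontier X" "Reeb p = torus_field b p" "p$j \<noteq> 0" for p b j
  proof -
    obtain q where q: "q \<in> C" "p \<in> V q"
      using C p by blast
    have "\<bar>b$j\<bar> \<le> L q"
      using VL(3)[of q p b j] q C(1) p by blast
    also have "\<dots> \<le> \<bar>L q\<bar>"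
      by (rule abs_ge_self)
    also have "\<dots> \<le> (\<Sum>q\<in>C. \<bar>L q\<bar>)"
      by (rule member_le_sum[OF q(1) _ C(2)]) simp
    finally show ?thesis .
  qed
  thus ?thesis
    by (intro exI ballI allI impI)
qed

section \<open>Positivity and finiteness of the systole\<close>

lemma Reeb_nonzero:
  assumes "p \<in> frontier X"
  shows "Reeb p \<noteq> 0"
proof -
  obtain g where g: "outer_normal X p g"
    using outer_normal_exists[OF assms] .
  have "cstruct (cstruct g) \<noteq> 0" "cstruct 0 = (0 :: complex^'n)"
    using g by (simp_all add: outer_normal_def vec_eq_iff)
  hence "cstruct g \<noteq> 0"
    by metis
  thus ?thesis
    using Reeb_eq[OF assms g] outer_normal_inner_pos[OF assms g] by simp
qed

text \<open>Some nonzero coordinate has nonzero speed. Over one period it makes a nonzero whole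
  number of turns, so \<open>\<tau> * \<bar>b$j\<bar>\<close> is at least
  \<open>2 * pi\<close>.\<close>

lemma periods_bounded_below:
  obtains c where "c > 0" "\<And>\<tau> \<gamma>. orbit \<tau> \<gamma> \<Longrightarrow> c \<le> \<tau>"
proof -
  obtain L where L: "\<And>p b j. p \<in> frontier X \<Longrightarrow> Reeb p = torus_field b p \<Longrightarrow> p$j \<noteq> 0 \<Longrightarrow> \<bar>b$j\<bar> \<le> L"
    using rotation_speed_bounded by blast
  \<comment> \<open>The maximum with 1 keeps the denominator positive.\<close>
  have "2 * pi / max L 1 \<le> \<tau>" if "orbit \<tau> \<gamma>" for \<tau> \<gamma>
  proof -
    have fr: "\<gamma> 0 \<in> frontier X" and \<tau>: "\<tau> > 0" "\<gamma> \<tau> = \<gamma> 0"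
      using that unfolding periodic_Reeb_orbit_def by (auto dest: spec[of _ 0])
    obtain b where b: "Reeb (\<gamma> 0) = torus_field b (\<gamma> 0)"
      using Reeb_eq_torus_field[OF fr] .
    obtain j where j: "b$j \<noteq> 0" "\<gamma> 0 $ j \<noteq> 0"
      using Reeb_nonzero[OF fr] unfolding b by (auto simp: vec_eq_iff)
    have "cis (\<tau> * b$j) * \<gamma> 0 $ j = \<gamma> 0 $ j"
      using periodic_Reeb_orbit_eq_torus_curve[OF that b, of \<tau>] \<tau>(2)
      by (metis torus_action_nth vector_scaleR_component real_scaleR_def)
    hence "cis (\<tau> * b$j) = 1"
      using j by simp
    hence "cos (\<tau> * b$j) = 1"
      by (metis cis.sel(1) one_complex.sel(1))
    then obtain k :: int where k: "\<tau> * b$j = of_int k * 2 * pi"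
      using cos_one_2pi_int by blast
    have "k \<noteq> 0"
      using k j \<tau> by auto
    hence "1 * (2 * pi) \<le> of_int \<bar>k\<bar> * (2 * pi)"
      by (intro mult_right_mono) auto
    also have "\<dots> = \<bar>\<tau> * b$j\<bar>"
      unfolding k by (simp add: abs_mult)
    also have "\<dots> \<le> \<tau> * max L 1"
      using L[OF fr b j(2)] \<tau> by (simp add: abs_mult le_max_iff_disj)
    finally show ?thesis
      by (simp add: field_simps)
  qed
  thus ?thesis
    using that[of "2 * pi / max L 1"] by simp
qed

text \<open>At a boundary point on a coordinate axis only one coordinate rotates, so the orbit
  closes after one full turn.\<close>

lemma periodic_Reeb_orbit_exists: "\<exists>\<tau> \<gamma>. orbit \<tau> \<gamma>"
proof -
  fix j :: 'n
  have "bounded X" "0 \<in> interior X"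
    using starshaped by (auto simp: smooth_compact_starshaped_def compact_imp_bounded)
  moreover have "axis j (1::complex) \<noteq> 0"
    by (simp add: axis_eq_0_iff)
  ultimately obtain d where d: "d > 0" "0 + d *\<^sub>R axis j 1 \<in> frontier X"
    using ray_to_frontier by metis
  define p :: "complex^'n" where "p = d *\<^sub>R axis j 1"
  have p: "p \<in> frontier X" "\<And>i. i \<noteq> j \<Longrightarrow> p$i = 0"
    using d by (auto simp: p_def axis_def)
  obtain b where b: "Reeb p = torus_field b p"
    using Reeb_eq_torus_field[OF p(1)] .
  have bj: "b$j \<noteq> 0"
    using Reeb_nonzero[OF p(1)] p(2) unfolding b by (auto simp: vec_eq_iff) (metis p(2))
  define \<tau> where "\<tau> = 2 * pi / \<bar>b$j\<bar>"
  have "cis (\<tau> * b$j) = 1"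
    using bj by (cases "b$j > 0") (auto simp: \<tau>_def complex_eq_iff)
  hence "torus_action (\<tau> *\<^sub>R b) p = p"
    using p(2) by (auto simp: vec_eq_iff) (metis mult_1 mult_zero_right)
  moreover have "\<tau> > 0"
    using bj by (simp add: \<tau>_def)
  ultimately show ?thesis
    using periodic_Reeb_orbit_torus_curve[OF p(1) b] by blast
qed

section \<open>Symmetric orbits and the symmetric ratio\<close>

text \<open>The torus orbit of \<open>\<gamma> 0\<close> contains the fixed point of \<open>rho \<theta>\<close> with coordinates
  \<open>cis (\<theta>$j / 2) * cmod (\<gamma> 0 $ j)\<close>, and \<open>rho \<theta>\<close> reverses the Reeb orbit through it.\<close>

lemma symmetric_orbit_exists:
  assumes "orbit \<tau> \<gamma>"
  shows "\<exists>\<gamma>'. orbit \<tau> \<gamma>' \<and> symmetric_curve (rho \<theta>) \<gamma>'"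
proof -
  have fr: "\<gamma> 0 \<in> frontier X" and \<tau>: "\<tau> > 0" "\<gamma> \<tau> = \<gamma> 0"
    using assms unfolding periodic_Reeb_orbit_def by (auto dest: spec[of _ 0])
  obtain b where b: "Reeb (\<gamma> 0) = torus_field b (\<gamma> 0)"
    using Reeb_eq_torus_field[OF fr] .
  define w :: "complex^'n" where "w = (\<chi> j. cis (\<theta>$j / 2) * complex_of_real (cmod (\<gamma> 0 $ j)))"
  obtain s where s: "w = torus_action s (\<gamma> 0)"
    by (rule torus_orbit[of "\<gamma> 0" w]) (auto simp: w_def norm_mult)
  define \<gamma>' where "\<gamma>' = (\<lambda>t. torus_action (t *\<^sub>R b) w)"
  \<comment> \<open>The torus is commutative, so the rotation that fixes \<open>\<gamma> 0\<close>
    also fixes its translate \<open>w\<close>.\<close>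
  have "torus_action (\<tau> *\<^sub>R b) w = w"
    unfolding s using periodic_Reeb_orbit_eq_torus_curve[OF assms b, of \<tau>] \<tau>(2)
    by (metis add.commute torus_action_add)
  hence orb: "orbit \<tau> \<gamma>'"
    unfolding \<gamma>'_def using frontier_invariant[OF fr] Reeb_torus_orbit[OF fr b] \<tau>(1)
    by (intro periodic_Reeb_orbit_torus_curve) (auto simp: s)
  have rev: "rho \<theta> (\<gamma>' t) = \<gamma>' (- t)" for t
  proof -
    \<comment> \<open>Conjugation negates both \<open>t * b$j\<close> and
      \<open>\<theta>$j / 2\<close>; the factor \<open>cis (\<theta>$j)\<close> restores the
      latter.\<close>
    have "cis (\<theta>$j) * cis (- (t * b$j)) * cis (- (\<theta>$j / 2)) = cis (- (t * b$j)) * cis (\<theta>$j / 2)" for j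
      by (simp add: cis_mult algebra_simps)
    thus ?thesis
      by (simp add: rho_def \<gamma>'_def w_def vec_eq_iff cis_cnj flip: cis_conv_exp mult.assoc)
  qed
  have "rho \<theta> ` range \<gamma>' = range (\<lambda>t. \<gamma>' (- t))"
    by (simp add: image_image rev)
  also have "\<dots> = range \<gamma>'"
    by (metis image_image surj_uminus)
  finally have "symmetric_curve (rho \<theta>) \<gamma>'"
    by (simp add: symmetric_curve_def)
  with orb show ?thesis by blast
qed

text \<open>Every period is also the period of a symmetric orbit, so both infima range over the same
  set. The infimum lies between a positive lower bound and an actual period, so the quotient is a
  genuine 1.\<close>

lemma symmetric_ratio_eq_1: "symmetric_ratio X liouville_form (rho \<theta>) = 1"
proof -
  have "symmetric_systole X liouville_form (rho \<theta>) = systole X liouville_form"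
    unfolding symmetric_systole_def systole_def using symmetric_orbit_exists
    by (intro arg_cong[where f = Inf]) blast
  moreover have "systole X liouville_form \<noteq> 0" "\<bar>systole X liouville_form\<bar> \<noteq> \<infinity>"
  proof -
    obtain c where c: "c > 0" "\<And>\<tau> \<gamma>. orbit \<tau> \<gamma> \<Longrightarrow> c \<le> \<tau>"
      using periods_bounded_below by blast
    obtain \<tau> \<gamma> where "orbit \<tau> \<gamma>"
      using periodic_Reeb_orbit_exists by blast
    hence "systole X liouville_form \<le> ereal \<tau>"
      unfolding systole_def by (intro Inf_lower) blast
    moreover have "ereal c \<le> systole X liouville_form"
      unfolding systole_def using c(2) by (intro Inf_greatest) auto
    ultimately show "systole X liouville_form \<noteq> 0" "\<bar>systole X liouville_form\<bar> \<noteq> \<infinity>"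
      using c(1) by (cases "systole X liouville_form"; simp)+
  qed
  ultimately show ?thesis
    unfolding symmetric_ratio_def by simp
qed

end

theorem mainTheorem2:
  fixes \<Omega> :: "(real^'n) set" and \<theta> :: "real^'n"
  assumes "\<Omega> \<subseteq> {x. \<forall>j. 0 \<le> x$j}"
    and "smooth_compact_starshaped (toric_domain \<Omega>)"
  shows "symmetric_ratio (toric_domain \<Omega>) liouville_form (rho \<theta>) = 1"
proof -
  \<comment> \<open>Rotations preserve the moduli of the coordinates and hence the moment map, which
    gives torus invariance.\<close>
  interpret toric_starshaped "toric_domain \<Omega>"
    by unfold_locales
       (use assms(2) in \<open>auto simp: toric_domain_def moment_map_def norm_mult\<close>)
  show ?thesis
    by (rule symmetric_ratio_eq_1)
qed

end
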